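(* There exist CSD families $\vec{A} = (A_1, A_2)$ and $\vec{B} = (B_1, B_2)$ in $C([-1, 1], \mathcal{M}_3)$ such that $\vec{A} \prec_c \vec{B}$ yet $\vec{A} \notin \mathrm{conv}(\mathcal{U}(\vec{B}))$.
   Context: $\mathcal{M}_n$ denotes the $n\times n$ complex matrices, $\mathcal{D}_n$ the diagonal matrices, and $C(\mathcal{X},\mathcal{M}_n)$ the continuous functions from $\mathcal{X}$ to $\mathcal{M}_n$. An abelian family in $C(\mathcal{X},\mathcal{M}_n)$ is an $m$-tuple $\vec{A}=(A_1,\dots,A_m)$ of pairwise commuting self-adjoint elements. Its (joint) unitary orbit is $\mathcal{U}(\vec{A})=\{(U^*A_1U,\dots,U^*A_mU) : U\in C(\mathcal{X},\mathcal{M}_n)\text{ unitary}\}$, and $\mathrm{conv}(\mathcal{U}(\vec{A}))$ is the convex hull (finite convex combinations, with constant coefficients) of this orbit. $DS_n$ is the set of doubly stochastic matrices: $n\times n$ matrices with non-negative entries all of whose row sums and column sums equal $1$. An abelian family $(A_1,\dots,A_m)$ in $C(\mathcal{X},\mathcal{M}_n)$ is continuously simultaneously diagonalizable (CSD) if there are a unitary $U\in C(\mathcal{X},\mathcal{M}_n)$ and $D_1,\dots,D_m\in C(\mathcal{X},\mathcal{D}_n)$ with $A_i=UD_iU^*$ for all $i$. For CSD families $\vec{A},\vec{B}$, write $A_j=U^*D_jU$, $B_j=V^*D_j'V$ with $U,V\in C(\mathcal{X},\mathcal{M}_n)$ unitary and $D_j,D_j'\in C(\mathcal{X},\mathcal{D}_n)$,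 and let $A,B\in C(\mathcal{X},\mathcal{M}_{n\times m})$ have as $j$-th columns the diagonals of $D_j$ and $D_j'$ respectively. Then $\vec{A}\prec_c\vec{B}$ means there is $X\in C(\mathcal{X},DS_n)$ with $XB=A$ (this does not depend on the chosen diagonalizations). *)

theory Defs
  imports "HOL-Analysis.Analysis" "HOL-Library.Function_Algebras"
begin

text \<open>
  Functions form a real vector space under the pointwise operations, so that
  \<^const>\<open>hull\<close> with \<^const>\<open>convex\<close> makes sense for tuples of matrix-valued functions.
\<close>

instantiation "fun" :: (type, real_vector) real_vector
begin

definition scaleR_fun :: "real \<Rightarrow> ('a \<Rightarrow> 'b) \<Rightarrow> 'a \<Rightarrow> 'b"
  where "scaleR_fun c f = (\<lambda>x. c *\<^sub>R f x)"

instance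
  by standard
    (simp_all add: scaleR_fun_def fun_eq_iff scaleR_add_right scaleR_add_left)

end

text \<open>
  \<open>C(X, S)\<close>: HOL functions are total, so a function on \<open>X\<close> is represented by its
  extension by zero outside \<open>X\<close>. Hence equality in \<open>C(X, S)\<close> is HOL equality, and
  \<open>C(X, UNIV)\<close> is a linear subspace of the space of all functions.
  Continuity is only required on \<open>X\<close>.
\<close>

definition cfuns ::
    "'x::topological_space set \<Rightarrow> 'a::{topological_space, zero} set \<Rightarrow> ('x \<Rightarrow> 'a) set"
  where "cfuns X S = {f. continuous_on X f \<and> f ` X \<subseteq> S \<and> (\<forall>x. x \<notin> X \<longrightarrow> f x = 0)}"

definition conj_transpose :: "complex^'n^'n \<Rightarrow> complex^'n^'n"
  where "conj_transpose M = map_matrix cnj (transpose M)"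

definition self_adjoint_mats :: "(complex^'n^'n) set"
  where "self_adjoint_mats = {M. conj_transpose M = M}"

definition unitary_mats :: "(complex^'n^'n) set"
  where "unitary_mats =
    {U. conj_transpose U ** U = mat 1 \<and> U ** conj_transpose U = mat 1}"

definition diagonal_mats :: "(complex^'n^'n) set"
  where "diagonal_mats = {D. \<forall>i j. i \<noteq> j \<longrightarrow> D $ i $ j = 0}"

definition doubly_stochastic_mats :: "(real^'n^'n) set"
  where "doubly_stochastic_mats =
    {P. (\<forall>i j. 0 \<le> P $ i $ j) \<and> (\<forall>i. (\<Sum>j\<in>UNIV. P $ i $ j) = 1) \<and>
        (\<forall>j. (\<Sum>i\<in>UNIV. P $ i $ j) = 1)}"

text \<open>An \<open>m\<close>-tuple of functions is a vector indexed by the finite type \<open>'m\<close>.\<close>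

definition abelian_family ::
    "'x::topological_space set \<Rightarrow> ('x \<Rightarrow> complex^'n^'n)^'m \<Rightarrow> bool"
  where "abelian_family X A \<longleftrightarrow>
    (\<forall>i. A $ i \<in> cfuns X self_adjoint_mats) \<and>
    (\<forall>i j. \<forall>x\<in>X. (A $ i) x ** (A $ j) x = (A $ j) x ** (A $ i) x)"

definition CSD :: "'x::topological_space set \<Rightarrow> ('x \<Rightarrow> complex^'n^'n)^'m \<Rightarrow> bool"
  where "CSD X A \<longleftrightarrow> abelian_family X A \<and>
    (\<exists>U \<in> cfuns X unitary_mats. \<exists>D :: ('x \<Rightarrow> complex^'n^'n)^'m.
      (\<forall>i. D $ i \<in> cfuns X diagonal_mats) \<and>
      (\<forall>i. \<forall>x\<in>X. (A $ i) x = U x ** (D $ i) x ** conj_transpose (U x)))"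

definition unitary_orbit ::
    "'x::topological_space set \<Rightarrow> ('x \<Rightarrow> complex^'n^'n)^'m \<Rightarrow> (('x \<Rightarrow> complex^'n^'n)^'m) set"
  where "unitary_orbit X A =
    {(\<chi> i. (\<lambda>x. conj_transpose (U x) ** (A $ i) x ** U x)) | U. U \<in> cfuns X unitary_mats}"

text \<open>The \<open>n \<times> m\<close> matrix whose \<open>j\<close>-th column is the diagonal of \<open>D\<^sub>j(x)\<close>.\<close>

definition diag_columns :: "('x \<Rightarrow> complex^'n^'n)^'m \<Rightarrow> 'x \<Rightarrow> complex^'m^'n"
  where "diag_columns D x = (\<chi> i j. (D $ j) x $ i $ i)"

text \<open>
  Meant for CSD families \<open>A\<close>, \<open>B\<close>. The relation does not depend on the chosen
  diagonalizations, so they are quantified existentially.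
\<close>

definition cmajorized ::
    "'x::topological_space set \<Rightarrow> ('x \<Rightarrow> complex^'n^'n)^'m \<Rightarrow> ('x \<Rightarrow> complex^'n^'n)^'m \<Rightarrow> bool"
  where "cmajorized X A B \<longleftrightarrow>
    (\<exists>U \<in> cfuns X unitary_mats. \<exists>V \<in> cfuns X unitary_mats.
     \<exists>D D' :: ('x \<Rightarrow> complex^'n^'n)^'m.
      (\<forall>j. D $ j \<in> cfuns X diagonal_mats) \<and> (\<forall>j. D' $ j \<in> cfuns X diagonal_mats) \<and>
      (\<forall>j. \<forall>x\<in>X. (A $ j) x = conj_transpose (U x) ** (D $ j) x ** U x) \<and>
      (\<forall>j. \<forall>x\<in>X. (B $ j) x = conj_transpose (V x) ** (D' $ j) x ** V x) \<and>
      (\<exists>P \<in> cfuns X doubly_stochastic_mats.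
        \<forall>x\<in>X. map_matrix complex_of_real (P x) ** diag_columns D' x = diag_columns D x))"

end

theory Submission
  imports Defs
begin

text \<open>
  Take a constant family \<open>B\<close> whose joint eigenvalues are three affinely independent points of the
  plane, and \<open>A = X B\<close> with \<open>X = (1 - t) I + t C\<close>, where \<open>C\<close> is a cyclic permutation matrix and \<open>t\<close>
  runs from \<open>0\<close> to \<open>1\<close>. If \<open>A\<close> is a convex combination of conjugates of \<open>B\<close> by unitaries \<open>U\<^sub>k\<close>,
  comparing diagonals shows that \<open>X\<close> is the same convex combination of the matrices \<open>Q\<^sub>k\<close> whose
  \<open>(i, j)\<close> entry is the squared modulus of the \<open>(j, i)\<close> entry of \<open>U\<^sub>k\<close>. Hence \<open>Q\<^sub>k\<close> vanishes
  where \<open>X\<close> does, and orthogonality of the rows of \<open>U\<^sub>k\<close> then forces it to be one of the permutation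
  matrices \<open>I\<close> and \<open>C\<close>. By continuity each is constant on the interval, whereas \<open>X\<close> is not.
\<close>

text \<open>Row \<open>i\<close> of \<open>d x\<close> is the \<open>i\<close>-th joint eigenvalue
  at \<open>x\<close>. Real entries give self-adjointness, and the value zero outside
  \<open>X\<close> is the convention of \<open>cfuns\<close>.\<close>

definition diag_family ::
    "'x set \<Rightarrow> ('x \<Rightarrow> real^'m^'n) \<Rightarrow> ('x \<Rightarrow> complex^'n^'n)^'m"
  where "diag_family X d =
    (\<chi> j. (\<lambda>x. if x \<in> X then (\<chi> i k. if i = k then complex_of_real (d x $ i $ j) else 0) else 0))"

lemma diag_family_entry:
  "x \<in> X \<Longrightarrow> (diag_family X d $ j) x $ i $ k = (if i = k then complex_of_real (d x $ i $ j) else 0)"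
  by (simp add: diag_family_def)

text \<open>The set \<open>S\<close> is left open so that both memberships behind
  \<open>CSD\<close>, self-adjoint and diagonal, are instances.\<close>

lemma diag_family_in_cfuns:
  fixes d :: "'x::topological_space \<Rightarrow> real^'m^'n"
  assumes d: "continuous_on X d"
    and S: "\<And>M :: complex^'n^'n. M \<in> diagonal_mats \<Longrightarrow> M \<in> self_adjoint_mats \<Longrightarrow> M \<in> S"
  shows "diag_family X d $ j \<in> cfuns X S"
proof -
  have "continuous_on X (\<lambda>x. (\<chi> i k. if i = k then complex_of_real (d x $ i $ j) else 0))"
    (is "continuous_on X ?f")
  proof (intro continuous_on_vec_lambda)
    fix i k :: 'n
    show "continuous_on X (\<lambda>x. if i = k then complex_of_real (d x $ i $ j) else 0)"
      by (cases "i = k") (auto intro!: continuous_intros d)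
  qed
  then have "continuous_on X (diag_family X d $ j)"
    by (rule continuous_on_eq) (simp add: diag_family_def)
  moreover have "?f x \<in> S" for x
    by (rule S) (auto simp: diagonal_mats_def self_adjoint_mats_def conj_transpose_def
        map_matrix_def transpose_def vec_eq_iff)
  ultimately show ?thesis
    by (auto simp: cfuns_def diag_family_def)
qed

lemma diag_family_mult_entry:
  assumes "x \<in> X"
  shows "((diag_family X d $ j) x ** M) $ i $ k = complex_of_real (d x $ i $ j) * M $ i $ k"
  by (simp add: matrix_matrix_mult_def diag_family_entry[OF assms] mult_delta_left)

lemma diag_family_commute:
  assumes "x \<in> X"
  shows "(diag_family X d $ i) x ** (diag_family X d $ j) x =
    (diag_family X d $ j) x ** (diag_family X d $ i) x"
  by (simp add: vec_eq_iff diag_family_mult_entry[OF assms] diag_family_entry[OF assms])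

lemma conj_transpose_mat_1: "conj_transpose (mat 1 :: complex^'n^'n) = mat 1"
  by (auto simp: vec_eq_iff conj_transpose_def map_matrix_def transpose_def mat_def)

lemma identity_in_cfuns:
  "(\<lambda>x. if x \<in> X then mat 1 else 0) \<in> cfuns X (unitary_mats :: (complex^'n^'n) set)"
proof -
  have "continuous_on X (\<lambda>x. if x \<in> X then mat 1 else 0 :: complex^'n^'n)"
    by (rule continuous_on_eq[OF continuous_on_const[of X "mat 1"]]) simp
  then show ?thesis
    by (auto simp: cfuns_def unitary_mats_def conj_transpose_mat_1)
qed

lemma CSD_diag_family:
  fixes d :: "'x::topological_space \<Rightarrow> real^'m^'n"
  assumes d: "continuous_on X d"
  shows "CSD X (diag_family X d)"
proof -
  have "abelian_family X (diag_family X d)"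
    unfolding abelian_family_def
    by (intro conjI allI ballI diag_family_commute diag_family_in_cfuns[OF d])
  moreover have "\<forall>j. diag_family X d $ j \<in> cfuns X diagonal_mats"
    by (intro allI diag_family_in_cfuns[OF d])
  ultimately show ?thesis
    unfolding CSD_def
    apply -
    apply (rule conjI, assumption)
    apply (rule bexI[OF _ identity_in_cfuns])
    apply (rule exI[of _ "diag_family X d"])
    apply (simp add: conj_transpose_mat_1)
    done
qed

lemma continuous_on_matrix_mult:
  fixes f :: "'x::topological_space \<Rightarrow> real^'k^'n" and g :: "'x \<Rightarrow> real^'m^'k"
  assumes "continuous_on X f" "continuous_on X g"
  shows "continuous_on X (\<lambda>x. f x ** g x)"
  unfolding matrix_matrix_mult_def
  by (intro continuous_on_vec_lambda continuous_on_sum continuous_on_mult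
      continuous_on_component assms)

text \<open>Both families are already diagonal, so the identity diagonalizes them and
  \<open>P\<close> itself is the required doubly stochastic function.\<close>

lemma cmajorized_diag_family:
  fixes d :: "'x::topological_space \<Rightarrow> real^'m^'n"
  assumes d: "continuous_on X d" and P: "P \<in> cfuns X doubly_stochastic_mats"
  shows "cmajorized X (diag_family X (\<lambda>x. P x ** d x)) (diag_family X d)"
proof -
  have "continuous_on X (\<lambda>x. P x ** d x)"
    using P d by (simp add: cfuns_def continuous_on_matrix_mult)
  then show ?thesis
    unfolding cmajorized_def using d P
    apply -
    apply (rule bexI[OF _ identity_in_cfuns])
    apply (rule bexI[OF _ identity_in_cfuns])
    apply (rule exI[of _ "diag_family X (\<lambda>x. P x ** d x)"])
    apply (rule exI[of _ "diag_family X d"])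
    apply (intro conjI allI ballI diag_family_in_cfuns bexI[OF _ P])
    apply (simp_all add: conj_transpose_mat_1)
    apply (simp add: vec_eq_iff diag_columns_def diag_family_entry
        matrix_matrix_mult_def map_matrix_def)
    done
qed

lemma cnj_mult_self: "cnj z * z = (complex_of_real (cmod z))\<^sup>2"
  using complex_norm_square[of z] by (simp add: mult.commute)

text \<open>Expanding the product weights the \<open>k\<close>-th eigenvalue by
  \<open>cnj z * z\<close> for \<open>z = U $ k $ i\<close>; this brings in the squared moduli of
  column \<open>i\<close>.\<close>

lemma unitary_conj_diag_entry:
  assumes "x \<in> X"
  shows "(conj_transpose U ** (diag_family X d $ j) x ** U) $ i $ i =
    complex_of_real (\<Sum>k\<in>UNIV. d x $ k $ j * (cmod (U $ k $ i))\<^sup>2)"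
proof -
  have "(conj_transpose U ** (diag_family X d $ j) x ** U) $ i $ i =
      (\<Sum>k\<in>UNIV. conj_transpose U $ i $ k * ((diag_family X d $ j) x ** U) $ k $ i)"
    unfolding matrix_mul_assoc[symmetric] by (simp add: matrix_matrix_mult_def)
  also have "\<dots> = (\<Sum>k\<in>UNIV. complex_of_real (d x $ k $ j * (cmod (U $ k $ i))\<^sup>2))"
    by (simp add: diag_family_mult_entry[OF assms] conj_transpose_def transpose_def
        flip: cnj_mult_self)
      (simp add: mult_ac)
  finally show ?thesis
    by simp
qed

lemma unitary_row_inner:
  assumes "U \<in> unitary_mats"
  shows "(\<Sum>k\<in>UNIV. U $ i $ k * cnj (U $ j $ k)) = (if i = j then 1 else 0)"
proof -
  have "(U ** conj_transpose U) $ i $ j = mat 1 $ i $ j"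
    using assms by (simp add: unitary_mats_def)
  then show ?thesis
    by (simp add: matrix_matrix_mult_def conj_transpose_def map_matrix_def transpose_def mat_def)
qed

lemma unitary_column_norm:
  assumes "U \<in> unitary_mats"
  shows "(\<Sum>k\<in>UNIV. (cmod (U $ k $ i))\<^sup>2) = 1"
proof -
  have "(conj_transpose U ** U) $ i $ i = 1"
    using assms by (simp add: unitary_mats_def mat_def)
  then have "complex_of_real (\<Sum>k\<in>UNIV. (cmod (U $ k $ i))\<^sup>2) = 1"
    by (simp add: matrix_matrix_mult_def conj_transpose_def map_matrix_def transpose_def
        cnj_mult_self)
  then show ?thesis
    using of_real_eq_1_iff by blast
qed

text \<open>The gaps \<open>c - f v\<close> are nonnegative with weighted sum zero, so each gap of
  positive weight vanishes.\<close>

lemma convex_combination_extreme: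
  fixes u f :: "'a \<Rightarrow> real"
  assumes "finite S" "\<forall>v\<in>S. 0 \<le> u v" "sum u S = 1" "\<forall>v\<in>S. f v \<le> c"
    and "(\<Sum>v\<in>S. u v * f v) = c" and v: "v \<in> S" "u v > 0"
  shows "f v = c"
proof -
  have "(\<Sum>v\<in>S. u v * (c - f v)) = 0"
    using assms by (simp add: right_diff_distrib sum_subtractf flip: sum_distrib_right)
  then have "u v * (c - f v) = 0"
    using assms by (subst (asm) sum_nonneg_eq_0_iff) auto
  then show ?thesis
    using v by simp
qed

lemma continuous_01_valued_const:
  fixes f :: "'x::topological_space \<Rightarrow> real"
  assumes X: "connected X" and f: "continuous_on X f" and 01: "\<forall>x\<in>X. f x = 0 \<or> f x = 1"
    and xy: "x \<in> X" "y \<in> X"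
  shows "f x = f y"
proof -
  have "finite (f ` X)"
    by (rule finite_subset[of _ "{0, 1}"]) (use 01 in auto)
  then have "f constant_on X"
    by (rule continuous_finite_range_constant[OF X f])
  then show ?thesis
    using xy by (auto simp: constant_on_def)
qed

definition cyclic_mix :: "real \<Rightarrow> real^3^3"
  where "cyclic_mix t =
    vector [vector [1 - t, t, 0], vector [0, 1 - t, t], vector [t, 0, 1 - t]]"

text \<open>With the standard simplex as eigenvalues, the two diagonals of a conjugate are exactly
  the squared moduli in the first two rows of the unitary.\<close>

definition simplex_points :: "real^2^3"
  where "simplex_points = vector [vector [1, 0], vector [0, 1], vector [0, 0]]"

text \<open>The substitution \<open>t = (x + 1) / 2\<close> carries the interval onto the parameter
  range from 0 to 1.\<close>

definition mix :: "real \<Rightarrow> real^3^3"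
  where "mix x = (if x \<in> {-1..1} then cyclic_mix ((x + 1) / 2) else 0)"

lemma mix_in_cfuns: "mix \<in> cfuns {-1..1} doubly_stochastic_mats"
proof -
  have "continuous_on {-1..1} (\<lambda>x. (\<chi> i j. cyclic_mix ((x + 1) / 2) $ i $ j))"
  proof (intro continuous_on_vec_lambda)
    fix i j :: 3
    show "continuous_on {-1..1} (\<lambda>x. cyclic_mix ((x + 1) / 2) $ i $ j)"
      using exhaust_3[of i] exhaust_3[of j]
      by (elim disjE) (simp_all add: cyclic_mix_def continuous_intros)
  qed
  then have "continuous_on {-1..1} mix"
    by (rule continuous_on_eq) (simp add: mix_def)
  then show ?thesis
    by (auto simp: cfuns_def mix_def doubly_stochastic_mats_def cyclic_mix_def forall_3 sum_3)
qed

lemma mix_not_in_convex_hull: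
  "diag_family {-1..1} (\<lambda>x. mix x ** simplex_points)
    \<notin> convex hull (unitary_orbit {-1..1} (diag_family {-1..1} (\<lambda>_. simplex_points)))"
  (is "?A \<notin> convex hull ?O")
proof
  assume "?A \<in> convex hull ?O"
  then obtain S u where S: "finite S" "S \<subseteq> ?O" "\<forall>v\<in>S. 0 \<le> u v" "sum u S = 1"
    and A: "(\<Sum>v\<in>S. u v *\<^sub>R v) = ?A"
    unfolding convex_hull_explicit by blast
  \<comment> \<open>This functional is real-linear in \<open>v\<close>, so it passes through the
    convex combination.\<close>
  define e where "e v j x i = Re ((v $ j) x $ i $ i)"
    for v :: "(real \<Rightarrow> complex^3^3)^2" and j x i
  have avg: "(\<Sum>v\<in>S. u v * e v j x i) = e ?A j x i" for j x i
  proof -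
    have "(\<Sum>v\<in>T. u v * e v j x i) = e (\<Sum>v\<in>T. u v *\<^sub>R v) j x i" if "finite T" for T
      using that
      by (induction T rule: finite_induct) (simp_all add: e_def scaleR_fun_def)
    from this[OF S(1)] show ?thesis
      unfolding A .
  qed
  have eA: "e ?A 1 x 1 = (1 - x) / 2" "e ?A 1 x 2 = 0" "e ?A 2 x 3 = 0"
    "e ?A 2 x 1 = (1 + x) / 2" if "x \<in> {-1..1}" for x
    using that by (simp_all add: e_def diag_family_entry matrix_matrix_mult_def sum_3 mix_def
        cyclic_mix_def simplex_points_def field_simps)
  have const: "e v 1 (-1) 1 = e v 1 1 1" if v: "v \<in> S" "u v > 0" for v
  proof (rule continuous_01_valued_const[of "{-1..1}" "\<lambda>x. e v 1 x 1"])
    have orbit: "\<exists>U \<in> cfuns {-1..1} unitary_mats. \<forall>x\<in>{-1..1}. \<forall>i.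
        e w 1 x i = (cmod (U x $ 1 $ i))\<^sup>2 \<and> e w 2 x i = (cmod (U x $ 2 $ i))\<^sup>2"
      if "w \<in> S" for w
    proof -
      obtain U where "U \<in> cfuns {-1..1} unitary_mats" and
        w: "w = (\<chi> i. (\<lambda>x. conj_transpose (U x) **
          (diag_family {-1..1} (\<lambda>_. simplex_points) $ i) x ** U x))"
        using S(2) \<open>w \<in> S\<close> unfolding unitary_orbit_def by blast
      then show ?thesis
        by (intro bexI[of _ U])
          (auto simp: e_def unitary_conj_diag_entry sum_3 simplex_points_def)
    qed
    from orbit[OF v(1)] obtain U where U: "U \<in> cfuns {-1..1} unitary_mats"
      and eU: "\<And>x i. x \<in> {-1..1} \<Longrightarrow> e v 1 x i = (cmod (U x $ 1 $ i))\<^sup>2"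
        "\<And>x i. x \<in> {-1..1} \<Longrightarrow> e v 2 x i = (cmod (U x $ 2 $ i))\<^sup>2"
      by blast
    have "continuous_on {-1..1} (\<lambda>x. (cmod (U x $ 1 $ 1))\<^sup>2)"
      using U by (auto simp: cfuns_def intro!: continuous_intros)
    then show "continuous_on {-1..1} (\<lambda>x. e v 1 x 1)"
      by (rule continuous_on_eq) (simp add: eU)
    show "\<forall>x\<in>{-1..1}. e v 1 x 1 = 0 \<or> e v 1 x 1 = 1"
    proof
      fix x :: real assume x: "x \<in> {-1..1}"
      \<comment> \<open>Column \<open>i\<close> of a unitary has norm one; the bound drops the third
        squared modulus.\<close>
      have bounds: "0 \<le> e w 1 x i \<and> 0 \<le> e w 2 x i \<and> e w 1 x i + e w 2 x i \<le> 1"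
        if w: "w \<in> S" for w i
      proof -
        obtain W where "W \<in> cfuns {-1..1} unitary_mats" and
          eW: "e w 1 x i = (cmod (W x $ 1 $ i))\<^sup>2" "e w 2 x i = (cmod (W x $ 2 $ i))\<^sup>2"
          using orbit[OF w] x by blast
        then have "W x \<in> unitary_mats"
          using x by (auto simp: cfuns_def)
        from unitary_column_norm[OF this, of i] show ?thesis
          unfolding sum_3 eW using zero_le_power2[of "cmod (W x $ 3 $ i)"]
          by (intro conjI zero_le_power2) linarith
      qed
      note extreme = convex_combination_extreme[OF S(1,3,4) _ _ v]
      \<comment> \<open>The average attains the minimum 0; the sign turns this into the upper bound
        that \<open>extreme\<close> expects.\<close>
      have "- e v 1 x 2 = 0"
      proof (rule extreme[where f = "\<lambda>w. - e w 1 x 2"])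
        show "\<forall>w\<in>S. - e w 1 x 2 \<le> 0"
          using bounds by simp
        show "(\<Sum>w\<in>S. u w * - e w 1 x 2) = 0"
          by (simp add: sum_negf avg eA[OF x])
      qed
      then have U12: "U x $ 1 $ 2 = 0"
        by (simp add: eU(1)[OF x])
      have "- e v 2 x 3 = 0"
      proof (rule extreme[where f = "\<lambda>w. - e w 2 x 3"])
        show "\<forall>w\<in>S. - e w 2 x 3 \<le> 0"
          using bounds by simp
        show "(\<Sum>w\<in>S. u w * - e w 2 x 3) = 0"
          by (simp add: sum_negf avg eA[OF x])
      qed
      then have U23: "U x $ 2 $ 3 = 0"
        by (simp add: eU(2)[OF x])
      \<comment> \<open>This encodes the remaining zero of the mixing matrix, at position (1, 3):
        the third entry in the first column of \<open>U x\<close> vanishes.\<close>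
      have "e v 1 x 1 + e v 2 x 1 = 1"
      proof (rule extreme[where f = "\<lambda>w. e w 1 x 1 + e w 2 x 1"])
        show "\<forall>w\<in>S. e w 1 x 1 + e w 2 x 1 \<le> 1"
          using bounds by blast
        show "(\<Sum>w\<in>S. u w * (e w 1 x 1 + e w 2 x 1)) = 1"
          by (simp add: distrib_left sum.distrib avg eA[OF x] flip: add_divide_distrib)
      qed
      moreover have "U x \<in> unitary_mats"
        using U x by (auto simp: cfuns_def)
      \<comment> \<open>Rows 1 and 2 are orthogonal, and the zeros \<open>U12\<close> and
        \<open>U23\<close> leave only the product of their first entries.\<close>
      then have "U x $ 1 $ 1 = 0 \<or> U x $ 2 $ 1 = 0"
        using unitary_row_inner[of "U x" 1 2] by (simp add: sum_3 U12 U23)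
      ultimately show "e v 1 x 1 = 0 \<or> e v 1 x 1 = 1"
        by (auto simp: eU[OF x])
    qed
  qed auto
  \<comment> \<open>\<open>const\<close> needs positive weight, so the weight stays as a factor.
    Summation makes the (1, 1) entry of the first member agree at both endpoints, where it is 1 and
    0.\<close>
  have "u v * e v 1 (-1) 1 = u v * e v 1 1 1" if "v \<in> S" for v
  proof (cases "u v = 0")
    case False
    then have "u v > 0"
      using S(3) that by (simp add: less_le)
    then show ?thesis
      using const[OF that] by simp
  qed simp
  then have "e ?A 1 (-1) 1 = e ?A 1 1 1"
    unfolding avg[symmetric] by (intro sum.cong) auto
  then show False
    using eA(1)[of "-1"] eA(1)[of 1] by simp
qed

theorem corollary3p4:
  shows "\<exists>A B :: (real \<Rightarrow> complex^3^3)^2.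
    CSD {-1..1} A \<and> CSD {-1..1} B \<and> cmajorized {-1..1} A B \<and>
    A \<notin> convex hull (unitary_orbit {-1..1} B)"
proof -
  have "continuous_on {-1..1} (\<lambda>x. mix x ** simplex_points)"
    using mix_in_cfuns
    by (simp add: cfuns_def continuous_on_matrix_mult)
  note CSD_diag_family[OF this] CSD_diag_family[OF continuous_on_const[of _ simplex_points]]
    cmajorized_diag_family[OF continuous_on_const[of _ simplex_points] mix_in_cfuns]
    mix_not_in_convex_hull
  then show ?thesis
    by blast
qed

end
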